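(* Suppose $\Sigma\subset\mathbb{R}^d$ is compact and the loss function $\ell(x,\xi)$ is upper semicontinuous in $\xi$ for every $x\in X$. For every $\epsilon>0$ and $r\ge0$, both smoothed KL-DRO predictors $\hat c=\hat c^{\epsilon}_{\mathrm{KL},W,r}$ and $\hat c=\hat c^{\epsilon}_{\mathrm{KL},\mathrm{LP},r}$ are uniformly feasible at rate $r$, i.e. $$\sup_{P\in\mathcal{P}(\Sigma)}\ \limsup_{N\to\infty}\frac1N\log\mathrm{Prob}\left[\exists x\in X\text{ such that }c(x,P)>\hat c(x,P_N)\right]\le -r .$$
   Context: $X\subseteq\mathbb{R}^m$ is a nonempty set of decisions. $\mathcal{P}(\Sigma)$ is the set of Borel probability measures on $\Sigma$ with the weak topology. The loss $\ell:X\times\Sigma\to\mathbb{R}$ is bounded below, and $c(x,P):=\int\ell(x,\xi)\,\mathrm{d}P(\xi)$. For $P\in\mathcal{P}(\Sigma)$, $\xi_1,\xi_2,\dots$ are i.i.d. samples from $P$, $P_N:=\frac1N\sum_{i=1}^N\delta_{\xi_i}$, and $\mathrm{Prob}$ is the probability under this sampling; $\log0=-\infty$. $W(P',P)=\inf\{\int\|\xi'-\xi\|\,\mathrm{d}\gamma(\xi',\xi):\gamma\in\Gamma(P',P)\}$ is the Wasserstein distance, $\Gamma(P',P)$ being the set of couplings of $P'$ and $P$. $\mathrm{LP}(P',P)=\inf\{\epsilon>0: P(S)\le P'(S^\epsilon)+\epsilon,\ P'(S)\le P(S^\epsilon)+\epsilon\ \text{for all Borel } S\subseteq\Sigma\}$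 is the Lévy–Prokhorov metric, with $S^\epsilon=\{\xi'\in\Sigma:\|\xi'-\xi\|\le\epsilon\text{ for some }\xi\in S\}$. $D_{\mathrm{KL}}(P',P)=\int\log\frac{\mathrm{d}P'}{\mathrm{d}P}\,\mathrm{d}P'$ if $P'\ll P$ and $+\infty$ otherwise. Smoothed divergences: $D^{\epsilon}_{\mathrm{KL},W}(P',P)=\inf\{D_{\mathrm{KL}}(Q,P):Q\in\mathcal{P}(\Sigma),\ W(P',Q)\le\epsilon\}$ and $D^{\epsilon}_{\mathrm{KL},\mathrm{LP}}(P',P)=\inf\{D_{\mathrm{KL}}(Q,P):Q\in\mathcal{P}(\Sigma),\ \mathrm{LP}(P',Q)\le\epsilon\}$. Smoothed predictors: $\hat c^{\epsilon}_{\mathrm{KL},W,r}(x,\hat P)=\sup\{c(x,P):P\in\mathcal{P}(\Sigma),\ D^{\epsilon}_{\mathrm{KL},W}(\hat P,P)\le r\}$ and $\hat c^{\epsilon}_{\mathrm{KL},\mathrm{LP},r}(x,\hat P)=\sup\{c(x,P):P\in\mathcal{P}(\Sigma),\ D^{\epsilon}_{\mathrm{KL},\mathrm{LP}}(\hat P,P)\le r\}$. *)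

theory Defs
  imports "HOL-Probability.Probability"
begin

definition prob_measures :: "'a::euclidean_space set \<Rightarrow> 'a measure set" where
  "prob_measures \<Sigma> = {P. prob_space P \<and> sets P = sets (restrict_space borel \<Sigma>)}"

definition usc_on :: "'a::topological_space set \<Rightarrow> ('a \<Rightarrow> real) \<Rightarrow> bool" where
  "usc_on \<Sigma> f \<longleftrightarrow> (\<forall>\<xi>\<in>\<Sigma>. \<forall>a. f \<xi> < a \<longrightarrow> (\<forall>\<^sub>F \<eta> in at \<xi> within \<Sigma>. f \<eta> < a))"

text \<open>The loss is used only when it is bounded below and upper semicontinuous on a compact
  set; it is then bounded and Borel there, so the Bochner integral is the Lebesgue integral.\<close>

definition expected_loss :: "('x \<Rightarrow> 'a \<Rightarrow> real) \<Rightarrow> 'x \<Rightarrow> 'a measure \<Rightarrow> real" where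
  "expected_loss loss x P = (\<integral>\<xi>. loss x \<xi> \<partial>P)"

definition couplings :: "'a measure \<Rightarrow> 'a measure \<Rightarrow> ('a \<times> 'a) measure set" where
  "couplings P' P = {\<gamma>. sets \<gamma> = sets (P' \<Otimes>\<^sub>M P) \<and> distr \<gamma> P' fst = P' \<and> distr \<gamma> P snd = P}"

definition wasserstein :: "'a::euclidean_space measure \<Rightarrow> 'a measure \<Rightarrow> ennreal" where
  "wasserstein P' P =
     (INF \<gamma>\<in>couplings P' P. \<integral>\<^sup>+ (\<xi>', \<xi>). ennreal (norm (\<xi>' - \<xi>)) \<partial>\<gamma>)"

definition fattening :: "'a::euclidean_space set \<Rightarrow> real \<Rightarrow> 'a set \<Rightarrow> 'a set" where
  "fattening \<Sigma> \<epsilon> S = {\<xi>'\<in>\<Sigma>. \<exists>\<xi>\<in>S. norm (\<xi>' - \<xi>) \<le> \<epsilon>}"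

text \<open>The closed fattening of a Borel set is analytic but in general not Borel. Its measure is
  understood in the completion, whose value on such a set is the outer measure; for Borel
  fattenings the outer measure is the measure itself.\<close>

definition levy_prokhorov ::
    "'a::euclidean_space set \<Rightarrow> 'a measure \<Rightarrow> 'a measure \<Rightarrow> ennreal" where
  "levy_prokhorov \<Sigma> P' P =
     Inf {ennreal \<epsilon> | \<epsilon>. \<epsilon> > 0 \<and>
       (\<forall>S\<in>sets (restrict_space borel \<Sigma>).
          emeasure P S \<le> outer_measure_of P' (fattening \<Sigma> \<epsilon> S) + ennreal \<epsilon> \<and>
          emeasure P' S \<le> outer_measure_of P (fattening \<Sigma> \<epsilon> S) + ennreal \<epsilon>)}"

text \<open>The arguments of the library notions are reversed: \<open>absolutely_continuous P P'\<close> says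
  \<open>P' \<lless> P\<close>, and \<open>KL_divergence b P P'\<close> is the Bochner integral of the logarithm to base \<open>b\<close>
  of \<open>dP'/dP\<close> with respect to \<open>P'\<close>. For probability measures the negative part of that
  logarithm is always \<open>P'\<close>-integrable, so failure of integrability means that the
  divergence is infinite.\<close>

definition KL :: "'a measure \<Rightarrow> 'a measure \<Rightarrow> ereal" where
  "KL P' P =
     (if absolutely_continuous P P' \<and> integrable P' (entropy_density (exp 1) P P')
      then ereal (KL_divergence (exp 1) P P') else \<infinity>)"

definition smoothed_KL ::
    "('a::euclidean_space measure \<Rightarrow> 'a measure \<Rightarrow> ennreal) \<Rightarrow> 'a set \<Rightarrow> real
      \<Rightarrow> 'a measure \<Rightarrow> 'a measure \<Rightarrow> ereal" where
  "smoothed_KL d \<Sigma> \<epsilon> P' P =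
     (INF Q\<in>{Q\<in>prob_measures \<Sigma>. d P' Q \<le> ennreal \<epsilon>}. KL Q P)"

definition KL_predictor ::
    "('a::euclidean_space measure \<Rightarrow> 'a measure \<Rightarrow> ennreal) \<Rightarrow> 'a set \<Rightarrow> ('x \<Rightarrow> 'a \<Rightarrow> real)
      \<Rightarrow> real \<Rightarrow> real \<Rightarrow> 'x \<Rightarrow> 'a measure \<Rightarrow> ereal" where
  "KL_predictor d \<Sigma> loss \<epsilon> r x P' =
     (SUP P\<in>{P\<in>prob_measures \<Sigma>. smoothed_KL d \<Sigma> \<epsilon> P' P \<le> ereal r}.
        ereal (expected_loss loss x P))"

definition empirical :: "'a measure \<Rightarrow> nat \<Rightarrow> (nat \<Rightarrow> 'a) \<Rightarrow> 'a measure" where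
  "empirical M N \<xi> =
     measure_of (space M) (sets M) (\<lambda>A. ennreal (1 / real N) * (\<Sum>i<N. emeasure (return M (\<xi> i)) A))"

lemma emeasure_empirical:
  assumes "A \<in> sets M"
  shows "emeasure (empirical M N \<xi>) A = ennreal (1 / real N) * (\<Sum>i<N. emeasure (return M (\<xi> i)) A)"
proof (rule emeasure_measure_of[OF empirical_def])
  show "sets M \<subseteq> Pow (space M)" by (rule sets.space_closed)
  show "A \<in> sets (empirical M N \<xi>)" using assms by (simp add: empirical_def)
  show "positive (sets (empirical M N \<xi>))
      (\<lambda>A. ennreal (1 / real N) * (\<Sum>i<N. emeasure (return M (\<xi> i)) A))"
    by (simp add: positive_def)
  show "countably_additive (sets (empirical M N \<xi>))
      (\<lambda>A. ennreal (1 / real N) * (\<Sum>i<N. emeasure (return M (\<xi> i)) A))"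
  proof (rule countably_additiveI)
    fix B :: "nat \<Rightarrow> _"
    assume B: "range B \<subseteq> sets (empirical M N \<xi>)" "disjoint_family B"
    then have B': "range B \<subseteq> sets M" by (simp add: empirical_def)
    show "(\<Sum>j. ennreal (1 / real N) * (\<Sum>i<N. emeasure (return M (\<xi> i)) (B j)))
        = ennreal (1 / real N) * (\<Sum>i<N. emeasure (return M (\<xi> i)) (\<Union>j. B j))"
      using suminf_emeasure[of B "return M (\<xi> _)"] B' B(2)
      by (simp add: ennreal_suminf_cmult suminf_sum suminf_emeasure)
  qed
qed

definition ln_ennreal :: "ennreal \<Rightarrow> ereal" where
  "ln_ennreal p = (if p = 0 then -\<infinity> else if p = \<infinity> then \<infinity> else ereal (ln (enn2real p)))"

text \<open>The samples form the coordinate process of the infinite product of \<open>P\<close>. The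
  disappointment event is a union over the possibly uncountable set \<open>X\<close>; outer measure is its
  probability whenever it is measurable, and avoids the value 0 that \<open>emeasure\<close> would
  otherwise assign by default.\<close>

definition disappointment_prob ::
    "'x set \<Rightarrow> ('x \<Rightarrow> 'a \<Rightarrow> real) \<Rightarrow> ('x \<Rightarrow> 'a measure \<Rightarrow> ereal) \<Rightarrow> 'a measure \<Rightarrow> nat \<Rightarrow> ennreal"
  where
  "disappointment_prob X loss c_hat P N =
     outer_measure_of (\<Pi>\<^sub>M i\<in>(UNIV::nat set). P)
       {\<xi> \<in> space (\<Pi>\<^sub>M i\<in>(UNIV::nat set). P).
          \<exists>x\<in>X. ereal (expected_loss loss x P) > c_hat x (empirical P N \<xi>)}"

definition uniformly_feasible ::
    "'x set \<Rightarrow> 'a::euclidean_space set \<Rightarrow> ('x \<Rightarrow> 'a \<Rightarrow> real) \<Rightarrow> ('x \<Rightarrow> 'a measure \<Rightarrow> ereal) \<Rightarrow> real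
      \<Rightarrow> bool" where
  "uniformly_feasible X \<Sigma> loss c_hat r \<longleftrightarrow>
     (SUP P\<in>prob_measures \<Sigma>.
        limsup (\<lambda>N. ereal (1 / real N) * ln_ennreal (disappointment_prob X loss c_hat P N)))
     \<le> - ereal r"

end

theory Submission
  imports Defs "HOL-Real_Asymp.Real_Asymp"
begin

text \<open>Partition \<open>\<Sigma>\<close> into finitely many Borel cells of diameter at most \<open>\<epsilon>\<close>. Reweighting \<open>P\<close> on each
  cell so that the cell masses become those of \<open>P\<^sub>N\<close> gives a measure \<open>Q\<close> within \<open>\<epsilon>\<close> of \<open>P\<^sub>N\<close> in both
  metrics, and \<open>KL Q P\<close> is the relative entropy of the empirical cell frequencies. Hence
  disappointment forces this relative entropy to exceed \<open>r\<close>. For each of the at most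
  \<open>(N + 1)\<^sup>k\<close> possible frequency vectors, Markov's inequality applied to the likelihood ratio of the
  sample bounds the probability by \<open>exp (- N r)\<close>.\<close>

section \<open>Measures with equal cell masses\<close>

text \<open>The coupling glues the two measures cell by cell: within each cell it is the
  normalised product.\<close>

lemma cellwise_coupling:
  fixes P Q :: "'a measure" and \<phi> :: "'a \<Rightarrow> nat"
  assumes "prob_space P" "prob_space Q" and sets: "sets Q = sets P"
    and phi [measurable]: "\<phi> \<in> P \<rightarrow>\<^sub>M count_space UNIV"
    and eq: "distr P (count_space UNIV) \<phi> = distr Q (count_space UNIV) \<phi>"
  shows "\<exists>\<gamma>\<in>couplings P Q. AE z in \<gamma>. \<phi> (fst z) = \<phi> (snd z)"
proof -
  interpret P: prob_space P by fact
  interpret Q: prob_space Q by fact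
  interpret PQ: pair_prob_space P Q ..
  have space: "space Q = space P"
    using sets by (rule sets_eq_imp_space_eq)
  have phiQ [measurable]: "\<phi> \<in> Q \<rightarrow>\<^sub>M count_space UNIV"
    using phi measurable_cong_sets[OF sets refl] by blast
  define \<mu> where "\<mu> = distr P (count_space UNIV) \<phi>"
  define m where "m j = emeasure \<mu> {j}" for j
  interpret \<mu>: prob_space \<mu>
    unfolding \<mu>_def by (rule P.prob_space_distr) simp
  have m_fin: "m j \<noteq> \<infinity>" for j
    by (simp add: m_def)
  have mP: "(\<integral>\<^sup>+x. (if \<phi> x = j then c else 0) \<partial>P) = c * m j" for j c
  proof -
    have "(\<integral>\<^sup>+x. (if \<phi> x = j then c else 0) \<partial>P) = (\<integral>\<^sup>+x. c * indicator (\<phi> -` {j} \<inter> space P) x \<partial>P)"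
      by (intro nn_integral_cong) (auto simp: indicator_def)
    also have "\<dots> = c * emeasure P (\<phi> -` {j} \<inter> space P)"
      by (intro nn_integral_cmult_indicator) (rule measurable_sets[OF phi], simp)
    finally show ?thesis by (simp add: m_def \<mu>_def emeasure_distr)
  qed
  have mQ: "(\<integral>\<^sup>+x. (if \<phi> x = j then c else 0) \<partial>Q) = c * m j" for j c
  proof -
    have "(\<integral>\<^sup>+x. (if \<phi> x = j then c else 0) \<partial>Q) = (\<integral>\<^sup>+x. c * indicator (\<phi> -` {j} \<inter> space Q) x \<partial>Q)"
      by (intro nn_integral_cong) (auto simp: indicator_def)
    also have "\<dots> = c * emeasure Q (\<phi> -` {j} \<inter> space Q)"
      by (intro nn_integral_cmult_indicator) (rule measurable_sets[OF phiQ], simp)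
    finally show ?thesis by (simp add: m_def \<mu>_def eq emeasure_distr)
  qed
  \<comment> \<open>There are only countably many cells, so all null ones can be discarded at once.
    This matters because the coupling density divides by \<open>m\<close>, and in
    \<open>ennreal\<close> the product \<open>1 / 0 * 0\<close> is 0, not 1.\<close>
  have mu_pos: "AE j in \<mu>. m j \<noteq> 0"
  proof -
    have "AE j in \<mu>. \<forall>i. m i = 0 \<longrightarrow> j \<noteq> i"
      unfolding AE_all_countable
    proof (intro allI)
      fix i show "AE j in \<mu>. m i = 0 \<longrightarrow> j \<noteq> i"
        by (cases "m i = 0") (auto simp: m_def \<mu>_def intro!: AE_I[where N="{i}"])
    qed
    then show ?thesis by eventually_elim auto
  qed
  have posP: "AE x in P. m (\<phi> x) \<noteq> 0"
    using mu_pos unfolding \<mu>_def by (subst (asm) AE_distr_iff) auto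
  have posQ: "AE x in Q. m (\<phi> x) \<noteq> 0"
    using mu_pos unfolding \<mu>_def eq by (subst (asm) AE_distr_iff) auto
  \<comment> \<open>Under the product measure the block of cell \<open>j\<close> with itself has
    mass \<open>m j * m j\<close>; the factor \<open>1 / m j\<close> corrects this to
    \<open>m j\<close>. Off the diagonal blocks the density vanishes, so both coordinates share a
    cell.\<close>
  define h where "h z = (if \<phi> (fst z) = \<phi> (snd z) then 1 / m (\<phi> (fst z)) else 0)" for z
  have [measurable]: "m \<in> count_space UNIV \<rightarrow>\<^sub>M borel" by simp
  \<comment> \<open>Equality of the two labels is written as a countable union over
    \<open>j\<close>, a form in which measurability can be derived automatically.\<close>
  have "(\<lambda>z. if \<exists>j. \<phi> (fst z) = j \<and> \<phi> (snd z) = j then 1 / m (\<phi> (fst z)) else 0)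
      \<in> borel_measurable (P \<Otimes>\<^sub>M Q)"
    by measurable
  then have h [measurable]: "h \<in> borel_measurable (P \<Otimes>\<^sub>M Q)"
    unfolding h_def by (rule measurable_cong[THEN iffD1, rotated]) auto
  define \<gamma> where "\<gamma> = density (P \<Otimes>\<^sub>M Q) h"
  have m_inv: "1 / m j * m j = 1" if "m j \<noteq> 0" for j
    using that m_fin[of j] by (simp add: ennreal_divide_times ennreal_divide_self less_top)
  have fst: "distr \<gamma> P fst = P"
  proof (rule measure_eqI)
    fix A assume "A \<in> sets (distr \<gamma> P fst)"
    then have [measurable]: "A \<in> sets P" by simp
    have "emeasure (distr \<gamma> P fst) A = emeasure \<gamma> (fst -` A \<inter> space (P \<Otimes>\<^sub>M Q))"
      by (subst emeasure_distr) (auto simp: \<gamma>_def)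
    also have "\<dots> = (\<integral>\<^sup>+z. h z * indicator A (fst z) \<partial>(P \<Otimes>\<^sub>M Q))"
      unfolding \<gamma>_def by (subst emeasure_density) (auto intro!: nn_integral_cong simp: indicator_def)
    also have "\<dots> = (\<integral>\<^sup>+x. \<integral>\<^sup>+y. h (x, y) * indicator A x \<partial>Q \<partial>P)"
      by (subst Q.nn_integral_fst[symmetric]) auto
    also have "\<dots> = (\<integral>\<^sup>+x. \<integral>\<^sup>+y. (if \<phi> y = \<phi> x then 1 / m (\<phi> x) * indicator A x else 0) \<partial>Q \<partial>P)"
      by (intro nn_integral_cong) (auto simp: h_def)
    \<comment> \<open>For fixed \<open>x\<close> the inner integral runs over the cell of
      \<open>x\<close>, whose \<open>Q\<close>-mass is again \<open>m (\<phi> x)\<close> since the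
      cell masses agree. This cancels the normalisation for almost every \<open>x\<close>.\<close>
    also have "\<dots> = (\<integral>\<^sup>+x. 1 / m (\<phi> x) * indicator A x * m (\<phi> x) \<partial>P)"
      by (simp only: mQ)
    also have "\<dots> = (\<integral>\<^sup>+x. indicator A x \<partial>P)"
      using posP by (intro nn_integral_cong_AE) (auto simp: indicator_def m_inv)
    finally show "emeasure (distr \<gamma> P fst) A = emeasure P A" by simp
  qed simp
  have snd: "distr \<gamma> Q snd = Q"
  proof (rule measure_eqI)
    fix A assume "A \<in> sets (distr \<gamma> Q snd)"
    then have [measurable]: "A \<in> sets Q" by simp
    have "emeasure (distr \<gamma> Q snd) A = emeasure \<gamma> (snd -` A \<inter> space (P \<Otimes>\<^sub>M Q))"
      by (subst emeasure_distr) (auto simp: \<gamma>_def)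
    also have "\<dots> = (\<integral>\<^sup>+z. h z * indicator A (snd z) \<partial>(P \<Otimes>\<^sub>M Q))"
      unfolding \<gamma>_def by (subst emeasure_density) (auto intro!: nn_integral_cong simp: indicator_def)
    also have "\<dots> = (\<integral>\<^sup>+y. \<integral>\<^sup>+x. h (x, y) * indicator A y \<partial>P \<partial>Q)"
      by (subst PQ.nn_integral_snd[symmetric]) (auto simp: split_beta')
    also have "\<dots> = (\<integral>\<^sup>+y. \<integral>\<^sup>+x. (if \<phi> x = \<phi> y then 1 / m (\<phi> y) * indicator A y else 0) \<partial>P \<partial>Q)"
      by (intro nn_integral_cong) (auto simp: h_def)
    also have "\<dots> = (\<integral>\<^sup>+y. 1 / m (\<phi> y) * indicator A y * m (\<phi> y) \<partial>Q)"
      by (simp only: mP)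
    also have "\<dots> = (\<integral>\<^sup>+y. indicator A y \<partial>Q)"
      using posQ by (intro nn_integral_cong_AE) (auto simp: indicator_def m_inv)
    finally show "emeasure (distr \<gamma> Q snd) A = emeasure Q A" by simp
  qed simp
  have "\<gamma> \<in> couplings P Q"
    using fst snd by (simp add: couplings_def \<gamma>_def)
  moreover have "AE z in \<gamma>. \<phi> (fst z) = \<phi> (snd z)"
    unfolding \<gamma>_def by (subst AE_density) (auto simp: h_def)
  ultimately show ?thesis by blast
qed

text \<open>The cellwise coupling moves mass only inside cells, so its transport cost is almost
  everywhere at most the cell diameter.\<close>

lemma wasserstein_le_cell_diameter:
  fixes P Q :: "'a::euclidean_space measure" and \<phi> :: "'a \<Rightarrow> nat"
  assumes P: "prob_space P" and Q: "prob_space Q" and sets: "sets Q = sets P"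
    and phi: "\<phi> \<in> P \<rightarrow>\<^sub>M count_space UNIV"
    and eq: "distr P (count_space UNIV) \<phi> = distr Q (count_space UNIV) \<phi>"
    and diam: "\<And>x y. x \<in> space P \<Longrightarrow> y \<in> space P \<Longrightarrow> \<phi> x = \<phi> y \<Longrightarrow> norm (x - y) \<le> \<epsilon>"
  shows "wasserstein P Q \<le> ennreal \<epsilon>"
proof -
  obtain \<gamma> where \<gamma>: "\<gamma> \<in> couplings P Q" and ae: "AE z in \<gamma>. \<phi> (fst z) = \<phi> (snd z)"
    using cellwise_coupling[OF P Q sets phi eq] by blast
  have sets_\<gamma>: "sets \<gamma> = sets (P \<Otimes>\<^sub>M Q)" and fst: "distr \<gamma> P fst = P"
    using \<gamma> by (auto simp: couplings_def)
  have space_\<gamma>: "space \<gamma> = space P \<times> space P"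
    using sets_eq_imp_space_eq[OF sets_\<gamma>] sets_eq_imp_space_eq[OF sets]
    by (simp add: space_pair_measure)
  \<comment> \<open>Membership in \<open>couplings\<close> does not mention total mass; it is 1
    because the first marginal is a probability measure.\<close>
  have "fst \<in> \<gamma> \<rightarrow>\<^sub>M P"
    by (subst measurable_cong_sets[OF sets_\<gamma> refl]) simp
  then have "prob_space \<gamma>"
    using P fst prob_space_distrD by metis
  have "wasserstein P Q \<le> (\<integral>\<^sup>+ (x, y). ennreal (norm (x - y)) \<partial>\<gamma>)"
    unfolding wasserstein_def by (rule INF_lower[OF \<gamma>])
  also have "\<dots> \<le> (\<integral>\<^sup>+ z. ennreal \<epsilon> \<partial>\<gamma>)"
    using ae by (intro nn_integral_mono_AE) (auto simp: space_\<gamma> intro!: ennreal_leI diam)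
  also have "\<dots> = ennreal \<epsilon>"
    using prob_space.emeasure_space_1[OF \<open>prob_space \<gamma>\<close>] by simp
  finally show ?thesis .
qed

text \<open>The union of the cells meeting \<open>S\<close> contains \<open>S\<close>, lies in its
  fattening, and has the same mass under both measures. The inequalities thus hold even before the
  additive \<epsilon> is granted.\<close>

lemma levy_prokhorov_le_cell_diameter:
  fixes P Q :: "'a::euclidean_space measure" and \<phi> :: "'a \<Rightarrow> nat"
  assumes P: "P \<in> prob_measures \<Sigma>" and Q: "Q \<in> prob_measures \<Sigma>"
    and phi: "\<phi> \<in> P \<rightarrow>\<^sub>M count_space UNIV"
    and eq: "distr P (count_space UNIV) \<phi> = distr Q (count_space UNIV) \<phi>"
    and diam: "\<And>x y. x \<in> \<Sigma> \<Longrightarrow> y \<in> \<Sigma> \<Longrightarrow> \<phi> x = \<phi> y \<Longrightarrow> norm (x - y) \<le> \<epsilon>"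
    and eps: "\<epsilon> > 0"
  shows "levy_prokhorov \<Sigma> P Q \<le> ennreal \<epsilon>"
proof -
  have sets: "sets P = sets (restrict_space borel \<Sigma>)" "sets Q = sets (restrict_space borel \<Sigma>)"
    using P Q by (auto simp: prob_measures_def)
  have space: "space P = \<Sigma>" "space Q = \<Sigma>"
    using sets[THEN sets_eq_imp_space_eq] by (auto simp: space_restrict_space)
  have phiQ: "\<phi> \<in> Q \<rightarrow>\<^sub>M count_space UNIV"
    using phi measurable_cong_sets[OF sets(1) refl] measurable_cong_sets[OF sets(2) refl] by blast
  have *: "emeasure B S \<le> outer_measure_of A (fattening \<Sigma> \<epsilon> S) + ennreal \<epsilon>"
    if S: "S \<in> sets (restrict_space borel \<Sigma>)"
      and A: "sets A = sets (restrict_space borel \<Sigma>)" "space A = \<Sigma>" "\<phi> \<in> A \<rightarrow>\<^sub>M count_space UNIV"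
      and B: "sets B = sets (restrict_space borel \<Sigma>)" "space B = \<Sigma>" "\<phi> \<in> B \<rightarrow>\<^sub>M count_space UNIV"
      and AB: "distr A (count_space UNIV) \<phi> = distr B (count_space UNIV) \<phi>"
    for A B S
  proof -
    have S_sub: "S \<subseteq> \<Sigma>"
      using sets.sets_into_space[OF S] by (simp add: space_restrict_space)
    \<comment> \<open>Every set of labels is measurable, so this union of cells is Borel even when
      the fattening is not. It is inserted between \<open>S\<close> and the fattening, and outer
      measure is needed only for the last inclusion.\<close>
    have meas: "\<phi> -` (\<phi> ` S) \<inter> \<Sigma> \<in> sets (restrict_space borel \<Sigma>)"
      using measurable_sets[OF A(3), of "\<phi> ` S"] A by simp
    have "emeasure B S \<le> emeasure B (\<phi> -` (\<phi> ` S) \<inter> \<Sigma>)"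
      using S_sub meas B by (intro emeasure_mono) auto
    also have "\<dots> = emeasure A (\<phi> -` (\<phi> ` S) \<inter> \<Sigma>)"
      using arg_cong[OF AB, of "\<lambda>M. emeasure M (\<phi> ` S)"] A B by (simp add: emeasure_distr)
    also have "\<dots> = outer_measure_of A (\<phi> -` (\<phi> ` S) \<inter> \<Sigma>)"
      using meas A by (simp add: outer_measure_of_eq)
    also have "\<dots> \<le> outer_measure_of A (fattening \<Sigma> \<epsilon> S)"
      using diam S_sub by (intro outer_measure_of_mono) (auto simp: fattening_def)
    finally show ?thesis
      by (simp add: add_increasing2)
  qed
  show ?thesis
    unfolding levy_prokhorov_def
    using eps *[OF _ sets(1) space(1) phi sets(2) space(2) phiQ eq]
      *[OF _ sets(2) space(2) phiQ sets(1) space(1) phi eq[symmetric]]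
    by (intro Inf_lower) auto
qed

section \<open>Reweighting cells to the empirical frequencies\<close>

text \<open>As a pushforward of the uniform measure on sample indices, the empirical measure
  composes with the cell map, and integrals become averages over the sample.\<close>

lemma empirical_eq_distr:
  assumes "N > 0" and xi: "\<And>i. i < N \<Longrightarrow> \<xi> i \<in> space M"
  shows "empirical M N \<xi> = distr (uniform_count_measure {..<N}) M \<xi>"
proof (rule measure_eqI)
  fix A assume "A \<in> sets (empirical M N \<xi>)"
  then have A: "A \<in> sets M" by (simp add: empirical_def)
  have xi': "\<xi> \<in> uniform_count_measure {..<N} \<rightarrow>\<^sub>M M"
    using xi by (subst measurable_cong_sets[OF sets_uniform_count_measure_count_space refl]) auto
  have "emeasure (distr (uniform_count_measure {..<N}) M \<xi>) A
      = ennreal (real (card (\<xi> -` A \<inter> {..<N})) / real N)"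
    using A xi' by (simp add: emeasure_distr space_uniform_count_measure emeasure_uniform_count_measure)
  also have "\<dots> = ennreal (1 / real N) * of_nat (card (\<xi> -` A \<inter> {..<N}))"
    by (simp add: ennreal_of_nat_eq_real_of_nat ennreal_mult[symmetric])
  also have "of_nat (card (\<xi> -` A \<inter> {..<N})) = (\<Sum>i<N. emeasure (return M (\<xi> i)) A)"
    using A by (simp add: indicator_def sum.If_cases Int_def vimage_def conj_commute)
  finally show "emeasure (empirical M N \<xi>) A = emeasure (distr (uniform_count_measure {..<N}) M \<xi>) A"
    using A by (simp add: emeasure_empirical)
qed (simp add: empirical_def)

lemma empirical_in_prob_measures:
  assumes P: "P \<in> prob_measures \<Sigma>" and N: "N > 0" and xi: "\<And>i. i < N \<Longrightarrow> \<xi> i \<in> space P"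
  shows "empirical P N \<xi> \<in> prob_measures \<Sigma>"
proof -
  have "prob_space (uniform_count_measure {..<N})"
    using N by (intro prob_space_uniform_count_measure) auto
  moreover have "\<xi> \<in> uniform_count_measure {..<N} \<rightarrow>\<^sub>M P"
    using xi by (subst measurable_cong_sets[OF sets_uniform_count_measure_count_space refl]) auto
  ultimately have "prob_space (empirical P N \<xi>)"
    by (simp add: empirical_eq_distr N xi prob_space.prob_space_distr)
  moreover have "sets (empirical P N \<xi>) = sets P"
    by (simp add: empirical_def)
  ultimately show ?thesis
    using P by (simp add: prob_measures_def)
qed

text \<open>\<open>Q\<close> keeps the conditional law of \<open>P\<close> inside each charged cell
  and changes only the cell masses. Its density is constant on cells, so its divergence from
  \<open>P\<close> is an average of log ratios over the sample. A sample in a \<open>P\<close>-null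
  cell would rule out absolute continuity, hence the positivity assumption.\<close>

lemma reweighted_measure:
  fixes P :: "'a::euclidean_space measure" and \<phi> :: "'a \<Rightarrow> nat"
  defines "p \<equiv> \<lambda>j. measure (distr P (count_space UNIV) \<phi>) {j}"
  assumes P: "P \<in> prob_measures \<Sigma>" and phi [measurable]: "\<phi> \<in> P \<rightarrow>\<^sub>M count_space UNIV"
    and N: "N > 0" and xi: "\<And>i. i < N \<Longrightarrow> \<xi> i \<in> space P"
    and pos: "\<And>i. i < N \<Longrightarrow> p (\<phi> (\<xi> i)) > 0"
  shows "\<exists>Q\<in>prob_measures \<Sigma>.
    distr Q (count_space UNIV) \<phi> = distr (empirical P N \<xi>) (count_space UNIV) \<phi> \<and>
    KL Q P = ereal ((\<Sum>i<N. ln (real (card {l. l < N \<and> \<phi> (\<xi> l) = \<phi> (\<xi> i)}) / real N / p (\<phi> (\<xi> i)))) / real N)"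
proof -
  interpret P: prob_space P using P by (simp add: prob_measures_def)
  let ?U = "uniform_count_measure {..<N}"
  define q where "q j = real (card {l. l < N \<and> \<phi> (\<xi> l) = j}) / real N" for j
  define g where "g j = q j / p j" for j
  define f where "f x = g (\<phi> x)" for x
  define Q where "Q = density P (\<lambda>x. ennreal (f x))"
  have f0: "f x \<ge> 0" for x by (simp add: f_def g_def q_def p_def)
  have f_meas [measurable]: "f \<in> borel_measurable P"
    unfolding f_def by measurable
  have setsQ [measurable_cong]: "sets Q = sets P" and spaceQ: "space Q = space P"
    by (simp_all add: Q_def)
  have xi_meas: "\<xi> \<in> ?U \<rightarrow>\<^sub>M P"
    using xi by (subst measurable_cong_sets[OF sets_uniform_count_measure_count_space refl]) auto
  have emp: "distr (empirical P N \<xi>) (count_space UNIV) \<phi> = distr ?U (count_space UNIV) (\<lambda>i. \<phi> (\<xi> i))"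
    using xi xi_meas by (simp add: empirical_eq_distr[OF N] distr_distr comp_def)
  have phixi: "(\<lambda>i. \<phi> (\<xi> i)) \<in> ?U \<rightarrow>\<^sub>M count_space UNIV"
    by (subst measurable_cong_sets[OF sets_uniform_count_measure_count_space refl]) auto
  have p_emeasure: "emeasure P (\<phi> -` {j} \<inter> space P) = ennreal (p j)" for j
    by (simp add: p_def measure_distr P.emeasure_eq_measure)
  \<comment> \<open>This makes \<open>g j * p j = q j\<close> true for every \<open>j\<close>,
    including null cells, where the real quotient \<open>q j / p j\<close> is 0 by
    convention.\<close>
  have q_pos: "q j = 0" if "p j = 0" for j
  proof -
    have "{l. l < N \<and> \<phi> (\<xi> l) = j} = {}"
      using that pos by fastforce
    then show ?thesis by (simp add: q_def)
  qed
  have distr_eq: "distr Q (count_space UNIV) \<phi> = distr ?U (count_space UNIV) (\<lambda>i. \<phi> (\<xi> i))"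
  proof (rule measure_eqI_countable[where A=UNIV])
    fix j
    have "emeasure (distr Q (count_space UNIV) \<phi>) {j} = emeasure Q (\<phi> -` {j} \<inter> space P)"
      by (simp add: emeasure_distr spaceQ)
    also have "\<dots> = (\<integral>\<^sup>+x. ennreal (f x) * indicator (\<phi> -` {j} \<inter> space P) x \<partial>P)"
      unfolding Q_def by (subst emeasure_density) auto
    also have "\<dots> = (\<integral>\<^sup>+x. ennreal (g j) * indicator (\<phi> -` {j} \<inter> space P) x \<partial>P)"
      by (intro nn_integral_cong) (auto simp: f_def indicator_def)
    also have "\<dots> = ennreal (g j) * ennreal (p j)"
      by (subst nn_integral_cmult_indicator) (auto simp: p_emeasure)
    also have "\<dots> = ennreal (q j)"
      using q_pos[of j] by (simp add: g_def ennreal_mult[symmetric] q_def p_def)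
    also have "\<dots> = emeasure ?U {l. l < N \<and> \<phi> (\<xi> l) = j}"
      by (subst emeasure_uniform_count_measure) (auto simp: q_def)
    also have "{l. l < N \<and> \<phi> (\<xi> l) = j} = (\<lambda>i. \<phi> (\<xi> i)) -` {j} \<inter> space ?U"
      by (auto simp: space_uniform_count_measure)
    also have "emeasure ?U \<dots> = emeasure (distr ?U (count_space UNIV) (\<lambda>i. \<phi> (\<xi> i))) {j}"
      using phixi by (simp add: emeasure_distr)
    finally show "emeasure (distr Q (count_space UNIV) \<phi>) {j} = \<dots>" .
  qed auto
  \<comment> \<open>The total mass of \<open>Q\<close> is read off from its pushforward, which has
    just been identified with that of a probability measure.\<close>
  have "prob_space ?U"
    using N by (intro prob_space_uniform_count_measure) auto
  then have "prob_space (distr Q (count_space UNIV) \<phi>)"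
    unfolding distr_eq using phixi by (rule prob_space.prob_space_distr)
  then have probQ: "prob_space Q"
    by (rule prob_space_distrD[rotated]) simp
  then have Q: "Q \<in> prob_measures \<Sigma>"
    using P by (simp add: prob_measures_def setsQ)
  have ac: "absolutely_continuous P Q"
    unfolding Q_def by (rule absolutely_continuousI_density) simp
  \<comment> \<open>The derivative is determined only up to \<open>P\<close>-null sets; as
    \<open>Q\<close> is a density over \<open>P\<close>, the identity passes to
    \<open>Q\<close>-almost every point, where the divergence is integrated.\<close>
  have "AE x in P. ennreal (f x) = RN_deriv P Q x"
    by (rule P.RN_deriv_unique) (auto simp: Q_def)
  then have "AE x in Q. ennreal (f x) = RN_deriv P Q x"
    unfolding Q_def by (subst AE_density) auto
  then have ae: "AE x in Q. entropy_density (exp 1) P Q x = ln (g (\<phi> x))"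
  proof eventually_elim
    case (elim x)
    then show ?case
      using f0[of x] by (simp add: entropy_density_def elim[symmetric] log_def f_def[symmetric])
  qed
  have ent_meas: "entropy_density (exp 1) P Q \<in> borel_measurable Q"
    unfolding entropy_density_def comp_def by measurable
  have phiQ: "\<phi> \<in> Q \<rightarrow>\<^sub>M count_space UNIV"
    by measurable
  have lng_meas: "(\<lambda>x. ln (g (\<phi> x))) \<in> borel_measurable Q"
    by (rule measurable_compose[OF phiQ]) simp
  \<comment> \<open>The log density factors through the cell label, and \<open>Q\<close> and the
    sample have the same label distribution. Integrability and the integral can therefore be
    computed on a finite index set.\<close>
  have "integrable ?U (\<lambda>i. ln (g (\<phi> (\<xi> i))))"
    unfolding uniform_count_measure_def by (rule integrable_point_measure_finite) simp
  then have "integrable (distr ?U (count_space UNIV) (\<lambda>i. \<phi> (\<xi> i))) (\<lambda>j. ln (g j))"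
    by (subst integrable_distr_eq[OF phixi]) auto
  then have "integrable Q (\<lambda>x. ln (g (\<phi> x)))"
    unfolding distr_eq[symmetric] by (subst (asm) integrable_distr_eq[OF phiQ]) auto
  then have int: "integrable Q (entropy_density (exp 1) P Q)"
    using integrable_cong_AE[OF ent_meas lng_meas ae] by blast
  have "KL_divergence (exp 1) P Q = (\<integral>x. ln (g (\<phi> x)) \<partial>Q)"
    unfolding KL_divergence_def by (rule integral_cong_AE[OF ent_meas lng_meas ae])
  also have "\<dots> = (\<integral>j. ln (g j) \<partial>distr Q (count_space UNIV) \<phi>)"
    by (subst integral_distr[OF phiQ]) auto
  also have "\<dots> = (\<integral>i. ln (g (\<phi> (\<xi> i))) \<partial>?U)"
    unfolding distr_eq by (subst integral_distr[OF phixi]) auto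
  also have "\<dots> = (\<Sum>i<N. ln (g (\<phi> (\<xi> i)))) / real N"
    by (simp add: integral_uniform_count_measure)
  finally have KL: "KL Q P = ereal ((\<Sum>i<N. ln (g (\<phi> (\<xi> i)))) / real N)"
    using ac int by (simp add: KL_def)
  have "distr Q (count_space UNIV) \<phi> = distr (empirical P N \<xi>) (count_space UNIV) \<phi>"
    by (simp only: distr_eq emp)
  then show ?thesis
    by (intro bexI[OF _ Q] conjI KL[unfolded g_def q_def])
qed

section \<open>The large deviation bound\<close>

text \<open>The integrand sees only the first \<open>N\<close> coordinates, so projecting the
  infinite product onto them reduces the claim to the product formula for finitely many
  factors.\<close>

lemma nn_integral_PiM_prod_iid:
  assumes "prob_space P" and f [measurable]: "f \<in> borel_measurable P"
  shows "(\<integral>\<^sup>+\<xi>. (\<Prod>i<N::nat. f (\<xi> i)) \<partial>(\<Pi>\<^sub>M i\<in>UNIV. P)) = (\<integral>\<^sup>+x. f x \<partial>P) ^ N"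
proof -
  interpret P: prob_space P by fact
  interpret S: product_prob_space "\<lambda>_::nat. P" UNIV ..
  have "(\<integral>\<^sup>+x. f x \<partial>P) ^ N = (\<integral>\<^sup>+\<xi>. (\<Prod>i<N. f (\<xi> i)) \<partial>(\<Pi>\<^sub>M i\<in>{..<N}. P))"
    by (subst S.product_nn_integral_prod) auto
  also have "\<dots> = (\<integral>\<^sup>+\<xi>. (\<Prod>i<N. f (\<xi> i))
      \<partial>distr (\<Pi>\<^sub>M i\<in>UNIV. P) (\<Pi>\<^sub>M i\<in>{..<N}. P) (\<lambda>\<xi>. restrict \<xi> {..<N}))"
    by (subst S.distr_PiM_restrict_finite) auto
  also have "\<dots> = (\<integral>\<^sup>+\<xi>. (\<Prod>i<N. f (\<xi> i)) \<partial>(\<Pi>\<^sub>M i\<in>UNIV. P))"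
    by (subst nn_integral_distr) (auto intro!: nn_integral_cong measurable_restrict_subset)
  finally show ?thesis ..
qed

text \<open>Cell \<open>j\<close> contributes \<open>q j / p j * p j\<close>. This is
  \<open>q j\<close> on charged cells but 0 on null ones, so equality can fail. When the
  \<open>q j\<close> sum to 1, the expected likelihood ratio is at most 1, as Markov's inequality
  requires.\<close>

lemma nn_integral_likelihood_ratio_le:
  fixes \<phi> :: "'a \<Rightarrow> nat" and q :: "nat \<Rightarrow> ennreal"
  assumes "prob_space P" and phi [measurable]: "\<phi> \<in> P \<rightarrow>\<^sub>M count_space UNIV"
    and range: "\<And>x. x \<in> space P \<Longrightarrow> \<phi> x < k"
  shows "(\<integral>\<^sup>+x. q (\<phi> x) / emeasure (distr P (count_space UNIV) \<phi>) {\<phi> x} \<partial>P) \<le> (\<Sum>j<k. q j)"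
proof -
  interpret P: prob_space P by fact
  define p where "p j = emeasure P (\<phi> -` {j} \<inter> space P)" for j
  have p: "emeasure (distr P (count_space UNIV) \<phi>) {j} = p j" for j
    by (simp add: p_def emeasure_distr)
  have cells: "\<phi> -` {j} \<inter> space P \<in> sets P" for j
    by (rule measurable_sets[OF phi]) simp
  have "(\<integral>\<^sup>+x. q (\<phi> x) / p (\<phi> x) \<partial>P)
      = (\<integral>\<^sup>+x. (\<Sum>j<k. q j / p j * indicator (\<phi> -` {j} \<inter> space P) x) \<partial>P)"
  proof (rule nn_integral_cong)
    fix x assume x: "x \<in> space P"
    have "(\<Sum>j<k. q j / p j * indicator (\<phi> -` {j} \<inter> space P) x)
        = (\<Sum>j<k. if j = \<phi> x then q j / p j else 0)"
      using x by (intro sum.cong) (auto simp: indicator_def)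
    then show "q (\<phi> x) / p (\<phi> x) = (\<Sum>j<k. q j / p j * indicator (\<phi> -` {j} \<inter> space P) x)"
      using range[OF x] by simp
  qed
  also have "\<dots> = (\<Sum>j<k. q j / p j * p j)"
  proof (subst nn_integral_sum)
    show "(\<Sum>j<k. \<integral>\<^sup>+x. q j / p j * indicator (\<phi> -` {j} \<inter> space P) x \<partial>P) = (\<Sum>j<k. q j / p j * p j)"
      unfolding p_def by (intro sum.cong refl nn_integral_cmult_indicator cells)
  qed (intro borel_measurable_times_ennreal borel_measurable_const borel_measurable_indicator cells)
  also have "\<dots> \<le> (\<Sum>j<k. q j)"
  proof (rule sum_mono)
    fix j
    have "p j < top"
      by (simp add: p_def less_top[symmetric])
    then have "p j / p j \<le> 1"
      by (cases "p j = 0") (simp_all add: ennreal_divide_self)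
    then have "q j * (p j / p j) \<le> q j * 1"
      by (rule mult_left_mono) simp
    then show "q j / p j * p j \<le> q j"
      unfolding ennreal_divide_times by simp
  qed
  finally show ?thesis by (simp add: p)
qed

text \<open>The metric enters only through \<open>d\<close>: equal cell masses force distance at
  most \<epsilon>. The disappointment event need not be measurable, so it is enclosed in a finite
  union of measurable events, one for each possible vector of cell counts.\<close>

lemma disappointment_prob_le:
  fixes P :: "'a::euclidean_space measure" and \<phi> :: "'a \<Rightarrow> nat"
  assumes P: "P \<in> prob_measures \<Sigma>" and N: "N > 0"
    and phi [measurable]: "\<phi> \<in> P \<rightarrow>\<^sub>M count_space UNIV"
    and range: "\<And>x. x \<in> \<Sigma> \<Longrightarrow> \<phi> x < k"
    and d: "\<And>P' Q. P' \<in> prob_measures \<Sigma> \<Longrightarrow> Q \<in> prob_measures \<Sigma> \<Longrightarrow>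
      distr P' (count_space UNIV) \<phi> = distr Q (count_space UNIV) \<phi> \<Longrightarrow> d P' Q \<le> ennreal \<epsilon>"
  shows "disappointment_prob X loss (KL_predictor d \<Sigma> loss \<epsilon> r) P N
    \<le> ennreal (real (N + 1) ^ k * exp (- (real N * r)))"
proof -
  interpret P: prob_space P using P by (simp add: prob_measures_def)
  have spaceP: "space P = \<Sigma>"
    using P sets_eq_imp_space_eq[of P "restrict_space borel \<Sigma>"]
    by (auto simp: prob_measures_def space_restrict_space)
  define S where "S = (\<Pi>\<^sub>M i\<in>(UNIV::nat set). P)"
  define \<mu> where "\<mu> = distr P (count_space UNIV) \<phi>"
  define p where "p j = measure \<mu> {j}" for j
  interpret \<mu>: prob_space \<mu>
    unfolding \<mu>_def by (rule P.prob_space_distr) simp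
  \<comment> \<open>Count vectors are taken extensional on \<open>{..<k}\<close>, so that they form
    a finite set of at most \<open>(N + 1) ^ k\<close> elements.\<close>
  define types where "types = {T \<in> {..<k} \<rightarrow>\<^sub>E {..N}. (\<Sum>j<k. T j) = N}"
  define L where "L T x = ennreal (real (T (\<phi> x)) / real N) / emeasure \<mu> {\<phi> x}"
    for T :: "nat \<Rightarrow> nat" and x
  \<comment> \<open>This says that the likelihood ratio of the sample, for frequencies
    \<open>T / N\<close> against \<open>P\<close>, is at least \<open>exp (N * r)\<close>, arranged
    in the shape of Markov's inequality.\<close>
  define E where "E T = {\<xi> \<in> space S. 1 \<le> ennreal (exp (- (real N * r))) * (\<Prod>i<N. L T (\<xi> i))}" for T
  have fin_PiE: "finite ({..<k} \<rightarrow>\<^sub>E {..N})"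
    by (rule finite_PiE) auto
  then have fin_types: "finite types"
    unfolding types_def by simp
  have card_types: "card types \<le> (N + 1) ^ k"
  proof -
    have "card types \<le> card ({..<k} \<rightarrow>\<^sub>E {..N})"
      unfolding types_def by (intro card_mono fin_PiE) auto
    then show ?thesis by (simp add: card_PiE)
  qed
  have [measurable]: "L T \<in> borel_measurable P" for T
  proof -
    have "(\<lambda>j. ennreal (real (T j) / real N) / emeasure \<mu> {j}) \<in> count_space UNIV \<rightarrow>\<^sub>M borel"
      by simp
    from measurable_compose[OF phi this] show ?thesis unfolding L_def .
  qed
  have prod_meas [measurable]: "(\<lambda>\<xi>. \<Prod>i<N. L T (\<xi> i)) \<in> borel_measurable S" for T
    unfolding S_def by measurable
  have E_sets [measurable]: "E T \<in> sets S" for T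
    unfolding E_def by measurable
  \<comment> \<open>By independence the expected likelihood ratio of the sample is the
    \<open>N\<close>-th power of a one-sample expectation. The latter is at most 1 because the
    frequencies of \<open>T\<close> sum to 1.\<close>
  have E_le: "emeasure S (E T) \<le> ennreal (exp (- (real N * r)))" if T: "T \<in> types" for T
  proof -
    have "(\<integral>\<^sup>+x. L T x \<partial>P) \<le> (\<Sum>j<k. ennreal (real (T j) / real N))"
      unfolding L_def \<mu>_def
      using nn_integral_likelihood_ratio_le[OF P.prob_space_axioms phi, of k "\<lambda>j. ennreal (real (T j) / real N)"]
        range spaceP by simp
    also have "\<dots> = ennreal (real (\<Sum>j<k. T j) / real N)"
      by (simp add: sum_ennreal sum_divide_distrib)
    also have "\<dots> = 1"
      using T N by (simp add: types_def)
    finally have L_le: "(\<integral>\<^sup>+x. L T x \<partial>P) ^ N \<le> 1"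
      by (rule power_le_one[rotated]) simp
    have "emeasure S (E T)
        \<le> ennreal (exp (- (real N * r))) * (\<integral>\<^sup>+\<xi>. (\<Prod>i<N. L T (\<xi> i)) * indicator (space S) \<xi> \<partial>S)"
      unfolding E_def by (rule nn_integral_Markov_inequality) auto
    also have "(\<integral>\<^sup>+\<xi>. (\<Prod>i<N. L T (\<xi> i)) * indicator (space S) \<xi> \<partial>S) = (\<integral>\<^sup>+\<xi>. (\<Prod>i<N. L T (\<xi> i)) \<partial>S)"
      by (intro nn_integral_cong) auto
    also have "\<dots> = (\<integral>\<^sup>+x. L T x \<partial>P) ^ N"
      unfolding S_def by (rule nn_integral_PiM_prod_iid[OF P.prob_space_axioms]) measurable
    also have "ennreal (exp (- (real N * r))) * \<dots> \<le> ennreal (exp (- (real N * r))) * 1"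
      by (intro mult_left_mono L_le) simp
    finally show ?thesis by simp
  qed
  \<comment> \<open>A disappointing sample lies in the event belonging to its own count vector
    \<open>n\<close>.\<close>
  have bad_subset: "{\<xi> \<in> space S. \<exists>x\<in>X. ereal (expected_loss loss x P)
      > KL_predictor d \<Sigma> loss \<epsilon> r x (empirical P N \<xi>)} \<subseteq> (\<Union>T\<in>types. E T)"
  proof safe
    fix \<xi> x assume \<xi>: "\<xi> \<in> space S"
      and bad: "ereal (expected_loss loss x P) > KL_predictor d \<Sigma> loss \<epsilon> r x (empirical P N \<xi>)"
    have xi: "\<xi> i \<in> space P" for i
      using \<xi> by (auto simp: S_def space_PiM)
    have phi_k: "\<phi> (\<xi> i) < k" for i
      using range xi spaceP by simp
    define n where "n j = card {l. l < N \<and> \<phi> (\<xi> l) = j}" for j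
    have n_pos: "n (\<phi> (\<xi> i)) > 0" if "i < N" for i
      using that by (auto simp: n_def card_gt_0_iff)
    have n_le: "n j \<le> N" for j
      using card_mono[of "{..<N}" "{l. l < N \<and> \<phi> (\<xi> l) = j}"] by (auto simp: n_def)
    have "(\<Sum>j<k. n j) = N"
      using sum.group[of "{..<N}" "{..<k}" "\<lambda>l. \<phi> (\<xi> l)" "\<lambda>_. 1::nat"] phi_k
      by (auto simp: n_def image_subset_iff)
    then have "restrict n {..<k} \<in> types"
      using n_le by (auto simp: types_def)
    moreover have "1 \<le> ennreal (exp (- (real N * r))) * (\<Prod>i<N. L (restrict n {..<k}) (\<xi> i))"
    proof (cases "\<exists>i<N. p (\<phi> (\<xi> i)) = 0")
      \<comment> \<open>With a sample in a \<open>P\<close>-null cell no reweighting of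
        \<open>P\<close> exists. But its factor is positive over zero, which is infinite in
        \<open>ennreal\<close>, and no other factor vanishes, so the product is infinite and the
        bound is immediate.\<close>
      case True
      then obtain i where i: "i < N" "emeasure \<mu> {\<phi> (\<xi> i)} = 0"
        by (auto simp: p_def \<mu>.emeasure_eq_measure)
      have L_pos: "L (restrict n {..<k}) (\<xi> l) \<noteq> 0" if "l < N" for l
        using n_pos[OF that] N phi_k[of l]
        by (auto simp: L_def ennreal_divide_eq_0_iff \<mu>.emeasure_eq_measure)
      have "L (restrict n {..<k}) (\<xi> i) = \<infinity>"
        using i n_pos[of i] N phi_k[of i] by (simp add: L_def ennreal_divide_zero)
      then have "(\<Prod>i<N. L (restrict n {..<k}) (\<xi> i)) = \<infinity>"
        using i L_pos by (subst prod.remove[of _ i]) (auto simp: ennreal_top_mult)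
      then show ?thesis
        by (simp add: ennreal_mult_top)
    next
      case False
      then have p_pos: "p (\<phi> (\<xi> i)) > 0" if "i < N" for i
        using that by (auto simp: p_def less_le)
      define \<rho> where "\<rho> i = real (n (\<phi> (\<xi> i))) / real N / p (\<phi> (\<xi> i))" for i
      have \<rho>_pos: "\<rho> i > 0" if "i < N" for i
        using n_pos[OF that] p_pos[OF that] N by (simp add: \<rho>_def)
      obtain Q where Q: "Q \<in> prob_measures \<Sigma>"
        and distrQ: "distr Q (count_space UNIV) \<phi> = distr (empirical P N \<xi>) (count_space UNIV) \<phi>"
        and KLQ: "KL Q P = ereal ((\<Sum>i<N. ln (\<rho> i)) / real N)"
        using reweighted_measure[OF P phi N, of \<xi>] xi p_pos
        unfolding \<rho>_def n_def p_def \<mu>_def by blast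
      have "d (empirical P N \<xi>) Q \<le> ennreal \<epsilon>"
        using empirical_in_prob_measures[OF P N, of \<xi>] xi Q distrQ by (intro d) auto
      then have smoothed: "smoothed_KL d \<Sigma> \<epsilon> (empirical P N \<xi>) P \<le> KL Q P"
        unfolding smoothed_KL_def using Q by (intro INF_lower) auto
      \<comment> \<open>Otherwise \<open>P\<close> itself would compete in the supremum defining the
        predictor, which would then be no smaller than the true expected loss.\<close>
      have "\<not> smoothed_KL d \<Sigma> \<epsilon> (empirical P N \<xi>) P \<le> ereal r"
      proof
        assume "smoothed_KL d \<Sigma> \<epsilon> (empirical P N \<xi>) P \<le> ereal r"
        then have "ereal (expected_loss loss x P) \<le> KL_predictor d \<Sigma> loss \<epsilon> r x (empirical P N \<xi>)"
          unfolding KL_predictor_def using P by (intro SUP_upper) auto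
        with bad show False by simp
      qed
      then have "\<not> (\<Sum>i<N. ln (\<rho> i)) / real N \<le> r"
        using order_trans[OF smoothed, of "ereal r"] KLQ by auto
      then have "real N * r \<le> (\<Sum>i<N. ln (\<rho> i))"
        using N by (simp add: field_simps)
      \<comment> \<open>Exponentiating \<open>N\<close> times the divergence of \<open>Q\<close>
        from \<open>P\<close> yields exactly the likelihood ratio of the sample.\<close>
      then have "1 \<le> exp (- (real N * r)) * exp (\<Sum>i<N. ln (\<rho> i))"
        by (simp add: exp_add[symmetric])
      also have "exp (\<Sum>i<N. ln (\<rho> i)) = (\<Prod>i<N. \<rho> i)"
        using \<rho>_pos by (simp add: exp_sum)
      finally have "1 \<le> ennreal (exp (- (real N * r)) * (\<Prod>i<N. \<rho> i))"
        by simp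
      also have "\<dots> = ennreal (exp (- (real N * r))) * (\<Prod>i<N. ennreal (\<rho> i))"
        using \<rho>_pos by (subst prod_ennreal) (auto simp: less_imp_le ennreal_mult')
      also have "(\<Prod>i<N. ennreal (\<rho> i)) = (\<Prod>i<N. L (restrict n {..<k}) (\<xi> i))"
      proof (intro prod.cong refl)
        fix i assume "i \<in> {..<N}"
        then have "p (\<phi> (\<xi> i)) > 0" by (simp add: p_pos)
        then have "ennreal (\<rho> i) = ennreal (real (n (\<phi> (\<xi> i))) / real N) / ennreal (p (\<phi> (\<xi> i)))"
          unfolding \<rho>_def by (simp add: divide_ennreal)
        then show "ennreal (\<rho> i) = L (restrict n {..<k}) (\<xi> i)"
          using phi_k[of i] by (simp add: L_def p_def \<mu>.emeasure_eq_measure)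
      qed
      finally show ?thesis .
    qed
    ultimately show "\<xi> \<in> (\<Union>T\<in>types. E T)"
      using \<xi> by (intro UN_I[of "restrict n {..<k}"]) (simp_all add: E_def)
  qed
  have "disappointment_prob X loss (KL_predictor d \<Sigma> loss \<epsilon> r) P N \<le> outer_measure_of S (\<Union>T\<in>types. E T)"
    unfolding disappointment_prob_def S_def[symmetric] by (rule outer_measure_of_mono[OF bad_subset])
  also have "\<dots> = emeasure S (\<Union>T\<in>types. E T)"
    using fin_types by (intro outer_measure_of_eq) auto
  also have "\<dots> \<le> (\<Sum>T\<in>types. emeasure S (E T))"
    using fin_types by (intro emeasure_subadditive_finite) auto
  also have "\<dots> \<le> (\<Sum>T\<in>types. ennreal (exp (- (real N * r))))"
    by (intro sum_mono E_le)
  also have "\<dots> = ennreal (real (card types) * exp (- (real N * r)))"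
    by (simp add: ennreal_mult ennreal_of_nat_eq_real_of_nat)
  also have "\<dots> \<le> ennreal (real ((N + 1) ^ k) * exp (- (real N * r)))"
    by (intro ennreal_leI mult_right_mono of_nat_mono card_types) simp
  also have "real ((N + 1) ^ k) = real (N + 1) ^ k"
    by (rule of_nat_power)
  finally show ?thesis .
qed

section \<open>Exponential rate and construction of the cells\<close>

lemma ln_ennreal_le:
  assumes "p \<le> ennreal c" "c > 0"
  shows "ln_ennreal p \<le> ereal (ln c)"
proof (cases "p = 0")
  case False
  have fin: "p \<noteq> \<infinity>"
    using assms(1) by (auto simp: top_unique)
  then have "enn2real p > 0"
    using False by (simp add: enn2real_positive_iff less_top zero_less_iff_neq_zero)
  moreover have "enn2real p \<le> c"
    using assms by (intro enn2real_leI) auto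
  ultimately show ?thesis
    using False fin by (simp add: ln_ennreal_def)
qed (simp add: ln_ennreal_def)

text \<open>The number of cells is fixed while \<open>N\<close> grows, so the polynomial factor
  costs only \<open>k * ln (N + 1) / N\<close>, which tends to 0. The same cells serve every
  \<open>P\<close>, since all members of \<open>prob_measures \<Sigma>\<close> share one
  sigma-algebra.\<close>

lemma uniformly_feasible_if_cells:
  fixes \<phi> :: "'a::euclidean_space \<Rightarrow> nat"
  assumes phi: "\<phi> \<in> restrict_space borel \<Sigma> \<rightarrow>\<^sub>M count_space UNIV"
    and range: "\<And>x. x \<in> \<Sigma> \<Longrightarrow> \<phi> x < k"
    and d: "\<And>P' Q. P' \<in> prob_measures \<Sigma> \<Longrightarrow> Q \<in> prob_measures \<Sigma> \<Longrightarrow>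
      distr P' (count_space UNIV) \<phi> = distr Q (count_space UNIV) \<phi> \<Longrightarrow> d P' Q \<le> ennreal \<epsilon>"
  shows "uniformly_feasible X \<Sigma> loss (KL_predictor d \<Sigma> loss \<epsilon> r) r"
  unfolding uniformly_feasible_def
proof (rule SUP_least)
  fix P assume P: "P \<in> prob_measures \<Sigma>"
  then have sets: "sets P = sets (restrict_space borel \<Sigma>)"
    by (simp add: prob_measures_def)
  have phiP: "\<phi> \<in> P \<rightarrow>\<^sub>M count_space UNIV"
    using phi measurable_cong_sets[OF sets refl] by blast
  let ?D = "\<lambda>N. disappointment_prob X loss (KL_predictor d \<Sigma> loss \<epsilon> r) P N"
  let ?b = "\<lambda>N. real k * ln (real (N + 1)) / real N - r"
  have bound: "ereal (1 / real N) * ln_ennreal (?D N) \<le> ereal (?b N)" if N: "N > 0" for N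
  proof -
    have "ln_ennreal (?D N) \<le> ereal (ln (real (N + 1) ^ k * exp (- (real N * r))))"
      using disappointment_prob_le[OF P N phiP range d] by (intro ln_ennreal_le) auto
    also have "ln (real (N + 1) ^ k * exp (- (real N * r))) = real k * ln (real (N + 1)) - real N * r"
      by (simp add: ln_mult ln_realpow del: of_nat_Suc)
    finally have "ereal (1 / real N) * ln_ennreal (?D N)
        \<le> ereal (1 / real N) * ereal (real k * ln (real (N + 1)) - real N * r)"
      by (intro ereal_mult_left_mono) auto
    also have "\<dots> = ereal (?b N)"
      using N by (simp add: field_simps)
    finally show ?thesis .
  qed
  have "?b \<longlonglongrightarrow> - r"
    by real_asymp
  then have lim: "(\<lambda>N. ereal (?b N)) \<longlonglongrightarrow> ereal (- r)"
    by simp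
  have "limsup (\<lambda>N. ereal (1 / real N) * ln_ennreal (?D N)) \<le> limsup (\<lambda>N. ereal (?b N))"
    using bound by (intro Limsup_mono) (auto simp: eventually_sequentially intro!: exI[of _ 1])
  also have "\<dots> = ereal (- r)"
    using lim by (rule lim_imp_Limsup[rotated]) simp
  finally show "limsup (\<lambda>N. ereal (1 / real N) * ln_ennreal (?D N)) \<le> - ereal r"
    by simp
qed

text \<open>Total boundedness gives finitely many balls of radius \<epsilon>/2 covering \<Sigma>.
  Labelling a point by the first ball containing it makes the cells disjoint, and two points with
  one label share a centre.\<close>

lemma compact_finite_cells:
  fixes \<Sigma> :: "'a::euclidean_space set"
  assumes "compact \<Sigma>" "\<epsilon> > 0"
  obtains \<phi> :: "'a \<Rightarrow> nat" and k where
    "\<phi> \<in> restrict_space borel \<Sigma> \<rightarrow>\<^sub>M count_space UNIV"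
    "\<And>x. x \<in> \<Sigma> \<Longrightarrow> \<phi> x < k"
    "\<And>x y. x \<in> \<Sigma> \<Longrightarrow> y \<in> \<Sigma> \<Longrightarrow> \<phi> x = \<phi> y \<Longrightarrow> norm (x - y) \<le> \<epsilon>"
proof -
  obtain C where C: "finite C" "\<Sigma> \<subseteq> (\<Union>c\<in>C. ball c (\<epsilon> / 2))"
    using assms compact_eq_totally_bounded[of \<Sigma>] by (metis half_gt_zero)
  obtain cs where cs: "set cs = C"
    using finite_list[OF C(1)] by blast
  \<comment> \<open>Outside the cover no index qualifies and the value is unspecified. This is
    harmless: the bounds concern only points of \<Sigma>, and measurability of a least index holds
    regardless.\<close>
  define \<phi> where "\<phi> x = (LEAST j. j < length cs \<and> x \<in> ball (cs ! j) (\<epsilon> / 2))" for x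
  have least: "\<phi> x < length cs \<and> x \<in> ball (cs ! \<phi> x) (\<epsilon> / 2)" if x: "x \<in> \<Sigma>" for x
  proof -
    have "\<exists>j. j < length cs \<and> x \<in> ball (cs ! j) (\<epsilon> / 2)"
      using C(2) x cs by (force simp: in_set_conv_nth)
    then show ?thesis
      unfolding \<phi>_def by (rule LeastI_ex)
  qed
  show thesis
  proof (rule that[of \<phi> "length cs"])
    have "\<phi> \<in> borel \<rightarrow>\<^sub>M count_space UNIV"
      unfolding \<phi>_def by (rule measurable_Least) simp
    then show "\<phi> \<in> restrict_space borel \<Sigma> \<rightarrow>\<^sub>M count_space UNIV"
      by (rule measurable_restrict_space1)
    show "\<phi> x < length cs" if "x \<in> \<Sigma>" for x
      using least[OF that] by simp
    show "norm (x - y) \<le> \<epsilon>" if "x \<in> \<Sigma>" "y \<in> \<Sigma>" "\<phi> x = \<phi> y" for x y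
    proof -
      have "dist (cs ! \<phi> x) x < \<epsilon> / 2" "dist (cs ! \<phi> x) y < \<epsilon> / 2"
        using least[OF that(1)] least[OF that(2)] that(3) by auto
      then have "dist x y < \<epsilon>"
        by (metis dist_commute dist_triangle_half_l)
      then show ?thesis by (simp add: dist_norm)
    qed
  qed
qed

theorem theorem5p2:
  fixes X :: "(real ^ 'm) set"
    and \<Sigma> :: "(real ^ 'd) set"
    and loss :: "real ^ 'm \<Rightarrow> real ^ 'd \<Rightarrow> real"
    and \<epsilon> r :: real
  assumes "X \<noteq> {}"
    and "compact \<Sigma>"
    and "\<exists>b. \<forall>x\<in>X. \<forall>\<xi>\<in>\<Sigma>. b \<le> loss x \<xi>"
    and "\<And>x. x \<in> X \<Longrightarrow> usc_on \<Sigma> (loss x)"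
    and "\<epsilon> > 0" and "r \<ge> 0"
  shows "uniformly_feasible X \<Sigma> loss (KL_predictor wasserstein \<Sigma> loss \<epsilon> r) r
       \<and> uniformly_feasible X \<Sigma> loss (KL_predictor (levy_prokhorov \<Sigma>) \<Sigma> loss \<epsilon> r) r"
proof -
  obtain \<phi> :: "real ^ 'd \<Rightarrow> nat" and k where
    phi: "\<phi> \<in> restrict_space borel \<Sigma> \<rightarrow>\<^sub>M count_space UNIV"
    and range: "\<And>x. x \<in> \<Sigma> \<Longrightarrow> \<phi> x < k"
    and diam: "\<And>x y. x \<in> \<Sigma> \<Longrightarrow> y \<in> \<Sigma> \<Longrightarrow> \<phi> x = \<phi> y \<Longrightarrow> norm (x - y) \<le> \<epsilon>"
    using compact_finite_cells[OF \<open>compact \<Sigma>\<close> \<open>\<epsilon> > 0\<close>] by blast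
  have phiP: "\<phi> \<in> P \<rightarrow>\<^sub>M count_space UNIV" and space: "space P = \<Sigma>"
    if "P \<in> prob_measures \<Sigma>" for P
    using that phi measurable_cong_sets[of P "restrict_space borel \<Sigma>" "count_space UNIV" "count_space UNIV"]
      sets_eq_imp_space_eq[of P "restrict_space borel \<Sigma>"]
    by (auto simp: prob_measures_def space_restrict_space)
  have "wasserstein P Q \<le> ennreal \<epsilon>"
    if "P \<in> prob_measures \<Sigma>" "Q \<in> prob_measures \<Sigma>"
      and "distr P (count_space UNIV) \<phi> = distr Q (count_space UNIV) \<phi>" for P Q
    using that phiP[OF that(1)] space[OF that(1)] diam
    by (intro wasserstein_le_cell_diameter[of P Q \<phi>]) (auto simp: prob_measures_def)
  moreover have "levy_prokhorov \<Sigma> P Q \<le> ennreal \<epsilon>"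
    if "P \<in> prob_measures \<Sigma>" "Q \<in> prob_measures \<Sigma>"
      and "distr P (count_space UNIV) \<phi> = distr Q (count_space UNIV) \<phi>" for P Q
    using that phiP[OF that(1)] diam \<open>\<epsilon> > 0\<close>
    by (intro levy_prokhorov_le_cell_diameter[of P \<Sigma> Q \<phi>]) auto
  ultimately show ?thesis
    using uniformly_feasible_if_cells[OF phi range] by blast
qed

end
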